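(* Let $f_2,f_3,f_4,\xi,\eta\in\mathbb{R}[x]$ be univariate polynomials with $\deg f_2\le 2$, $\deg f_3\le 3$, $\deg f_4\le 4$, $\deg\xi\le 2$, $\deg\eta\le 3$, and let $t\ne 0$ be a real number such that $$\eta^2=(f_2-t\xi)(4f_4-\xi^2)-f_3^2 .$$ For $i,j\in\{2,3,4\}$ put $g_{ij}=i f_i f_j'-j f_j f_i'$. Assume that $$\gcd(f_3,f_4)=1,\quad \gcd(g_{23},g_{24})=1,\quad \gcd(g_{34},g_{24})=1,\quad \Phi_{3,4}(f_3,f_2^2,f_4)\ne 0,$$ and that $f_3$ and $f_6:=4f_2f_4-f_3^2$ are separable. Suppose that there exists an irreducible quadratic polynomial $p\in\mathbb{R}[x]$ that divides both polynomials $$t\xi^3-f_2\xi^2-4tf_4\xi+4f_2f_4-f_3^2\qquad\text{and}\qquad 3t\xi^2-2f_2\xi-4tf_4 .$$ Then $$\Phi_{8,9}(P,A,B)=0,$$ where $$P=g_{24}^2-g_{23}g_{34},\qquad A=g_{23}\,(g_{23}f_3-2g_{24}f_2),\qquad B=g_{24}g_{34}$$ (polynomials of degrees at most $8$, $9$, $9$, respectively).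
   Context: $f'$ denotes the derivative of $f\in\mathbb{R}[x]$ with respect to $x$. A univariate polynomial is separable if it is nonzero and has no multiple root in an algebraic closure. Write $\mathbb{R}[x]_{\le d}$ for the space of polynomials of degree at most $d$. For integers $m,n\ge 2$, $\Phi_{m,n}(f,g,h)$ denotes a fixed form (homogeneous polynomial) with coefficients in $\mathbb{Z}$ in the coefficients of a triple $(f,g,h)$ of univariate polynomials with $\deg(f)\le m$ and $\deg(g),\deg(h)\le n$, having the following property: whenever $f\in\mathbb{R}[x]_{\le m}$ is separable with $\deg(f)\ge m-1$, and $g,h\in\mathbb{R}[x]_{\le n}$ are linearly independent, then $\Phi_{m,n}(f,g,h)=0$ if and only if there exists a pair $(s,t)\ne(0,0)$ of complex numbers such that $f$ and $sg+th$ have a common factor of degree at least two.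
   Formalization: In the property defining Φ_{m,n}, f and sg+th are read as binary forms of degrees m and n, so that a common root at infinity counts when deg f = m−1; with ordinary common factors no such form Φ_{m,n} exists. *)

theory Defs
  imports
    Complex_Main
    "HOL-Library.Poly_Mapping"
    "HOL-Computational_Algebra.Polynomial"
begin

abbreviation cpoly :: "real poly \<Rightarrow> complex poly" where
  "cpoly \<equiv> map_poly of_real"

text \<open>The complex numbers serve as the algebraic closure of the reals.\<close>

definition separable :: "real poly \<Rightarrow> bool" where
  "separable f \<longleftrightarrow> f \<noteq> 0 \<and> (\<forall>z. order z (cpoly f) \<le> 1)"

definition lin_indep2 :: "real poly \<Rightarrow> real poly \<Rightarrow> bool" where
  "lin_indep2 g h \<longleftrightarrow> (\<forall>a b. smult a g + smult b h = 0 \<longrightarrow> a = 0 \<and> b = 0)"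

text \<open>
  The indeterminates of a form in the coefficients of a triple (f, g, h): \<^term>\<open>CF i\<close>,
  \<^term>\<open>CG i\<close>, \<^term>\<open>CH i\<close> stand for the coefficients of x^i in f, g, h.
  A polynomial in them with integer coefficients is a finitely supported map from
  monomials (finitely supported exponent vectors) to the integers.
\<close>

datatype coeff_var = CF nat | CG nat | CH nat

type_synonym int_mpoly = "(coeff_var \<Rightarrow>\<^sub>0 nat) \<Rightarrow>\<^sub>0 int"

definition coeff_vars :: "nat \<Rightarrow> nat \<Rightarrow> coeff_var set" where
  "coeff_vars m n = CF ` {..m} \<union> CG ` {..n} \<union> CH ` {..n}"

definition total_deg :: "(coeff_var \<Rightarrow>\<^sub>0 nat) \<Rightarrow> nat" where
  "total_deg \<mu> = (\<Sum>v\<in>Poly_Mapping.keys \<mu>. Poly_Mapping.lookup \<mu> v)"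

definition is_form :: "nat \<Rightarrow> nat \<Rightarrow> int_mpoly \<Rightarrow> bool" where
  "is_form m n \<Phi> \<longleftrightarrow>
     (\<forall>\<mu>\<in>Poly_Mapping.keys \<Phi>. Poly_Mapping.keys \<mu> \<subseteq> coeff_vars m n) \<and>
     (\<exists>d. \<forall>\<mu>\<in>Poly_Mapping.keys \<Phi>. total_deg \<mu> = d)"

fun coeff_val :: "real poly \<Rightarrow> real poly \<Rightarrow> real poly \<Rightarrow> coeff_var \<Rightarrow> real" where
  "coeff_val f g h (CF i) = coeff f i"
| "coeff_val f g h (CG i) = coeff g i"
| "coeff_val f g h (CH i) = coeff h i"

definition eval_form :: "int_mpoly \<Rightarrow> real poly \<Rightarrow> real poly \<Rightarrow> real poly \<Rightarrow> real" where
  "eval_form \<Phi> f g h =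
     (\<Sum>\<mu>\<in>Poly_Mapping.keys \<Phi>. of_int (Poly_Mapping.lookup \<Phi> \<mu>) * (\<Prod>v\<in>Poly_Mapping.keys \<mu>. coeff_val f g h v ^ Poly_Mapping.lookup \<mu> v))"

text \<open>
  A common factor of degree at least two of f and q, viewed as binary forms of the formal
  degrees m and n: z^k times the homogenization of d divides both homogenizations.
  If f has degree exactly m then k = 0 and this is an ordinary common factor of degree at
  least two (lemma below).  If f has degree m - 1, a common root at infinity is counted, as
  it has to be.  With ordinary common factors only, no polynomial \<Phi> has the property
  required in \<open>is_Phi\<close>.  Take m = n = 2 and f = h = (x - 1)(e x - 1), g = x^2: for small
  e > 0 the polynomial f is separable of degree 2 and divides 0 g + 1 h, so \<Phi> vanishes;
  letting e tend to 0, \<Phi> vanishes at f = h = 1 - x, g = x^2, although f then has no factor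
  of degree two.
\<close>

definition common_factor_ge2 :: "nat \<Rightarrow> nat \<Rightarrow> complex poly \<Rightarrow> complex poly \<Rightarrow> bool" where
  "common_factor_ge2 m n f q \<longleftrightarrow>
     (\<exists>d k. d dvd f \<and> d dvd q \<and> degree f + k \<le> m \<and> degree q + k \<le> n \<and> 2 \<le> degree d + k)"

lemma common_factor_ge2_full_degree:
  assumes "degree f = m" "degree q \<le> n"
  shows "common_factor_ge2 m n f q \<longleftrightarrow> (\<exists>d. d dvd f \<and> d dvd q \<and> 2 \<le> degree d)"
proof
  assume "\<exists>d. d dvd f \<and> d dvd q \<and> 2 \<le> degree d"
  then obtain d where "d dvd f" "d dvd q" "2 \<le> degree d" by blast
  then show "common_factor_ge2 m n f q"
    unfolding common_factor_ge2_def using assms by (intro exI[of _ d] exI[of _ 0]) auto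
qed (use assms in \<open>auto simp: common_factor_ge2_def\<close>)

definition is_Phi :: "nat \<Rightarrow> nat \<Rightarrow> int_mpoly \<Rightarrow> bool" where
  "is_Phi m n \<Phi> \<longleftrightarrow> is_form m n \<Phi> \<and>
     (\<forall>f g h. degree f \<le> m \<and> degree g \<le> n \<and> degree h \<le> n \<and>
        separable f \<and> m - 1 \<le> degree f \<and> lin_indep2 g h \<longrightarrow>
        (eval_form \<Phi> f g h = 0 \<longleftrightarrow>
          (\<exists>s t :: complex. (s, t) \<noteq> (0, 0) \<and>
             common_factor_ge2 m n (cpoly f) (smult s (cpoly g) + smult t (cpoly h)))))"

definition gbr :: "nat \<Rightarrow> nat \<Rightarrow> real poly \<Rightarrow> real poly \<Rightarrow> real poly" where
  "gbr i j fi fj = of_nat i * fi * pderiv fj - of_nat j * fj * pderiv fi"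

text \<open>
  The terms of degree i + j - 1 cancel; this is why P, A, B in the theorem have degrees at
  most 8, 9, 9.
\<close>

lemma coeff_mult_top:
  fixes a b :: "real poly"
  assumes "degree a \<le> i" "degree b \<le> j"
  shows "coeff (a * b) (i + j) = coeff a i * coeff b j"
proof (cases "degree a = i \<and> degree b = j")
  case True
  then show ?thesis using coeff_mult_degree_sum[of a b] by simp
next
  case False
  then have "degree a < i \<or> degree b < j" using assms by auto
  moreover from this have "degree (a * b) < i + j"
    using degree_mult_le[of a b] assms by linarith
  ultimately show ?thesis by (auto simp: coeff_eq_0)
qed

lemma degree_gbr_le:
  assumes "degree a \<le> i" "degree b \<le> j" "1 \<le> i" "1 \<le> j"
  shows "degree (gbr i j a b) \<le> i + j - 2"
proof (rule degree_le, intro allI impI)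
  fix k assume k: "i + j - 2 < k"
  define u where "u = a * pderiv b"
  define v where "v = b * pderiv a"
  have g: "gbr i j a b = smult (of_nat i) u - smult (of_nat j) v"
    by (simp add: gbr_def u_def v_def of_nat_poly)
  have da: "degree (pderiv a) \<le> i - 1" and db: "degree (pderiv b) \<le> j - 1"
    using assms by (auto simp: degree_pderiv)
  have du: "degree u \<le> i + (j - 1)"
    unfolding u_def using degree_mult_le[of a "pderiv b"] assms db by linarith
  have dv: "degree v \<le> j + (i - 1)"
    unfolding v_def using degree_mult_le[of b "pderiv a"] assms da by linarith
  show "coeff (gbr i j a b) k = 0"
  proof (cases "k = i + j - 1")
    case True
    then have k1: "k = i + (j - 1)" and k2: "k = j + (i - 1)" using assms by auto
    have "coeff u k = coeff a i * (of_nat j * coeff b j)"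
      unfolding u_def k1 using coeff_mult_top[OF assms(1) db] assms(4) by (simp add: coeff_pderiv)
    moreover have "coeff v k = coeff b j * (of_nat i * coeff a i)"
      unfolding v_def k2 using coeff_mult_top[OF assms(2) da] assms(3) by (simp add: coeff_pderiv)
    ultimately show ?thesis by (simp add: g)
  next
    case False
    then have "degree u < k" "degree v < k" using k du dv assms by linarith+
    then show ?thesis by (simp add: g coeff_eq_0)
  qed
qed

end

theory Submission
  imports
    Defs
    "HOL-Computational_Algebra.Field_as_Ring"
    "HOL-Computational_Algebra.Polynomial_Factorial"
    "HOL-Number_Theory.Cong"
begin

text \<open>
  The first polynomial that p divides is \<eta>^2, so p divides \<eta>, and p also divides the derivative
  of \<eta>^2.  With w = t \<xi> - f2 there are two cases.

  If p divides w, then p divides f3 and f2^2 - 4 t^2 f4, which contradicts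
  \<Phi> 3 4 (f3, f2^2, f4) \<noteq> 0.  Otherwise f3 is congruent to 2 y w modulo p for some y, and
  the congruences that express the double root of the cubic polynomial give
  g24 = - y g23 and g34 = y^2 g23 modulo p.  Therefore p divides both P and A - 4 t^2 B.

  A form \<Phi> vanishes whenever f and a combination s g + t h have a common irreducible
  quadratic factor, because degenerate triples are limits of triples to which the defining
  property of \<Phi> applies.
\<close>

section \<open>Complexification and square-free polynomials\<close>

lemma cpoly_add: "cpoly (a + b) = cpoly a + cpoly b"
  by (rule poly_eqI) (simp add: coeff_map_poly)

lemma cpoly_mult: "cpoly (a * b) = cpoly a * cpoly b"
  by (rule poly_eqI) (simp add: coeff_map_poly coeff_mult)

lemma cpoly_smult: "cpoly (smult c a) = smult (of_real c) (cpoly a)"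
  by (rule poly_eqI) (simp add: coeff_map_poly)

lemma cpoly_pderiv: "cpoly (pderiv a) = pderiv (cpoly a)"
  by (rule poly_eqI) (simp add: coeff_map_poly coeff_pderiv)

lemma degree_cpoly: "degree (cpoly a) = degree a"
  by (rule degree_map_poly) simp

lemma cpoly_dvd: "a dvd b \<Longrightarrow> cpoly a dvd cpoly b"
  by (auto simp: dvd_def cpoly_mult)

text \<open>Makes \<open>rsquarefree_roots\<close> available: separability becomes the absence of a
  common complex zero of f and its derivative.\<close>

lemma separable_iff_rsquarefree: "separable f \<longleftrightarrow> rsquarefree (cpoly f)"
proof -
  have "cpoly f = 0 \<longleftrightarrow> f = 0" by (rule map_poly_eq_0_iff) simp_all
  moreover have "n \<le> 1 \<longleftrightarrow> n = 0 \<or> n = 1" for n :: nat by linarith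
  ultimately show ?thesis by (simp only: separable_def rsquarefree_def)
qed

lemma rsquarefree_mult:
  fixes a b :: "'a::field_char_0 poly"
  assumes "rsquarefree a" "rsquarefree b" "\<And>z. poly a z = 0 \<Longrightarrow> poly b z \<noteq> 0"
  shows "rsquarefree (a * b)"
  using assms by (auto simp: rsquarefree_roots pderiv_mult)

lemma rsquarefree_prod_linear:
  fixes r :: "nat \<Rightarrow> 'a::field_char_0"
  assumes "inj r"
  shows "rsquarefree (\<Prod>i<k. [:- r i, 1:])"
proof (induction k)
  case (Suc k)
  have "rsquarefree ((\<Prod>i<k. [:- r i, 1:]) * [:- r k, 1:])"
  proof (rule rsquarefree_mult[OF Suc])
    show "rsquarefree [:- r k, 1:]" by (simp add: rsquarefree_roots pderiv_pCons)
  next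
    fix z assume "poly (\<Prod>i<k. [:- r i, 1:]) z = 0"
    then obtain i where "i < k" "z = r i" by (auto simp: poly_prod)
    then show "poly [:- r k, 1:] z \<noteq> 0" using injD[OF assms, of i k] by auto
  qed
  then show ?case by (simp add: mult.commute)
qed (simp add: rsquarefree_roots)

section \<open>Wronskians and pencils with a double root\<close>

lemma lead_coeff_pderiv:
  fixes q :: "'a::field_char_0 poly"
  shows "lead_coeff (pderiv q) = of_nat (degree q) * lead_coeff q"
proof (cases "degree q = 0")
  case True
  then show ?thesis by (simp add: pderiv_eq_0_iff)
next
  case False
  then have "Suc (degree q - 1) = degree q" by simp
  then show ?thesis by (simp only: degree_pderiv coeff_pderiv)
qed

text \<open>Comparing leading coefficients equates the two degrees as elements of the field, and
  characteristic 0 turns this into an equality of naturals.\<close>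

lemma wronskian_0_imp_degree_eq:
  fixes a b :: "'a::field_char_0 poly"
  assumes "a * pderiv b = pderiv a * b" "a \<noteq> 0" "b \<noteq> 0"
  shows "degree a = degree b"
  using arg_cong[OF assms(1), of lead_coeff] assms(2,3)
  by (simp add: lead_coeff_mult lead_coeff_pderiv)

text \<open>
  A double root z of a + e b is a zero of the Wronskian of a and b, and z determines e.
  If the Wronskian is 0, then a is a scalar multiple of b.
\<close>

lemma finite_not_rsquarefree_pencil:
  fixes a b :: "'a::field_char_0 poly"
  assumes b: "rsquarefree b"
  shows "finite {e. \<not> rsquarefree (a + smult e b)}"
proof (cases "a * pderiv b - pderiv a * b = 0")
  case False
  let ?Z = "{z. poly (a * pderiv b - pderiv a * b) z = 0}"
  have "{e. \<not> rsquarefree (a + smult e b)} \<subseteq>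
      (\<lambda>z. - poly a z / poly b z) ` ?Z \<union> (\<lambda>z. - poly (pderiv a) z / poly (pderiv b) z) ` ?Z"
  proof
    fix e assume "e \<in> {e. \<not> rsquarefree (a + smult e b)}"
    then obtain z where "poly a z + e * poly b z = 0" "poly (pderiv a) z + e * poly (pderiv b) z = 0"
      by (auto simp: rsquarefree_roots pderiv_add pderiv_smult)
    then have z: "poly a z = - (e * poly b z)" "poly (pderiv a) z = - (e * poly (pderiv b) z)"
      by (simp_all add: eq_neg_iff_add_eq_0)
    then have "z \<in> ?Z" by simp
    \<comment> \<open>A square-free \<open>b\<close> has no zero in common with its derivative, so
      at least one of the two equations in \<open>z\<close> can be solved for
      \<open>e\<close>.\<close>
    moreover have "e = - poly a z / poly b z \<or> e = - poly (pderiv a) z / poly (pderiv b) z"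
      using b z by (auto simp: rsquarefree_roots)
    ultimately show "e \<in> (\<lambda>z. - poly a z / poly b z) ` ?Z \<union>
        (\<lambda>z. - poly (pderiv a) z / poly (pderiv b) z) ` ?Z"
      by blast
  qed
  then show ?thesis
    by (rule finite_subset) (intro finite_UnI finite_imageI poly_roots_finite[OF False])
next
  case True
  have b0: "b \<noteq> 0" using b by (simp add: rsquarefree_def)
  \<comment> \<open>Cancels the coefficient of \<open>a\<close> at \<open>degree b\<close>, so a
    nonzero \<open>a - smult c b\<close> cannot have the degree of \<open>b\<close>.\<close>
  define c where "c = coeff a (degree b) / lead_coeff b"
  have "a - smult c b = 0"
  proof (rule ccontr)
    assume nz: "a - smult c b \<noteq> 0"
    have "(a - smult c b) * pderiv b = pderiv (a - smult c b) * b"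
      using True by (simp add: pderiv_diff pderiv_smult algebra_simps)
    then have "degree (a - smult c b) = degree b"
      using wronskian_0_imp_degree_eq nz b0 by blast
    moreover have "coeff (a - smult c b) (degree b) = 0"
      using b0 by (simp add: c_def)
    ultimately show False using nz by (metis leading_coeff_0_iff)
  qed
  then have a: "a = smult c b" by simp
  have "{e. \<not> rsquarefree (a + smult e b)} \<subseteq> {- c}"
  proof
    fix e assume e: "e \<in> {e. \<not> rsquarefree (a + smult e b)}"
    have "a + smult e b = smult (c + e) b" by (simp add: a smult_add_left)
    then have "rsquarefree (a + smult e b)" if "c + e \<noteq> 0"
      using b that by (simp add: rsquarefree_roots pderiv_smult)
    then show "e \<in> {- c}" using e by (auto simp: eq_neg_iff_add_eq_0 add.commute)
  qed
  then show ?thesis by (rule finite_subset) simp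
qed

section \<open>Separable multiples of an irreducible quadratic\<close>

lemma irreducible_quadratic_no_real_root:
  fixes p :: "'a::field poly"
  assumes "irreducible p" "2 \<le> degree p"
  shows "poly p x \<noteq> 0"
proof
  assume "poly p x = 0"
  then obtain q where q: "p = [:- x, 1:] * q" by (auto simp: poly_eq_0_iff_dvd)
  then have "is_unit [:- x, 1:] \<or> is_unit q" using assms(1) irreducibleD by blast
  moreover have "\<not> is_unit [:- x, 1:]" by (simp add: is_unit_pCons_iff)
  moreover have "degree p = 1" if "is_unit q"
    using that assms(1) q by (auto simp: is_unit_poly_iff irreducible_def)
  ultimately show False using assms(2) by auto
qed

text \<open>In characteristic 0 the derivative of p is nonzero and of smaller degree, hence coprime
  to p. The Bezout identity survives complexification and excludes a common complex zero.\<close>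

lemma irreducible_imp_separable:
  assumes "irreducible p"
  shows "separable p"
proof -
  have p0: "p \<noteq> 0" and "\<not> is_unit p" using assms by (auto simp: irreducible_def)
  then have d: "degree p \<noteq> 0" by (simp add: is_unit_iff_degree)
  have "\<not> p dvd pderiv p"
    using d dvd_imp_degree_le[of p "pderiv p"] by (auto simp: degree_pderiv pderiv_eq_0_iff)
  then have "coprime p (pderiv p)"
    using assms field_poly_irreducible_imp_prime prime_elem_imp_coprime by blast
  then obtain u v where "u * p + v * pderiv p = 1"
    using bezout_coefficients_fst_snd[of p "pderiv p"] by (metis coprime_imp_gcd_eq_1)
  then have "cpoly (u * p + v * pderiv p) = 1" by simp
  then have *: "cpoly u * cpoly p + cpoly v * pderiv (cpoly p) = 1"
    by (simp only: cpoly_add cpoly_mult cpoly_pderiv)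
  have "poly (cpoly u) z * poly (cpoly p) z + poly (cpoly v) z * poly (pderiv (cpoly p)) z = 1" for z
    using arg_cong[OF *, of "\<lambda>q. poly q z"] by simp
  then show ?thesis
    unfolding separable_iff_rsquarefree rsquarefree_roots
    by (metis add.right_neutral mult_zero_right zero_neq_one)
qed

lemma poly_cpoly_of_real: "poly (cpoly a) (of_real x) = of_real (poly a x)"
  by (induction a) (simp_all add: map_poly_pCons)

lemma cpoly_prod: "cpoly (\<Prod>i\<in>I. a i) = (\<Prod>i\<in>I. cpoly (a i))"
  by (induction I rule: infinite_finite_induct) (simp_all add: cpoly_mult)

text \<open>Supplies the direction in which a degenerate f is perturbed. The cofactor of p has the
  distinct real roots 0, ..., m - 3, and p has no real root.\<close>

lemma obtain_separable_multiple:
  assumes "irreducible p" "degree p = 2" "2 \<le> m"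
  obtains F where "p dvd F" "separable F" "degree F = m"
proof
  let ?c = "\<Prod>i<m - 2. [:- real i, 1:]"
  have c: "cpoly ?c = (\<Prod>i<m - 2. [:- complex_of_real (real i), 1:])"
    by (simp add: cpoly_prod map_poly_pCons)
  show "p dvd p * ?c" by simp
  show "degree (p * ?c) = m"
    using assms by (subst degree_mult_eq) (auto simp: degree_prod_eq_sum_degree)
  have "rsquarefree (cpoly p * cpoly ?c)"
  proof (rule rsquarefree_mult)
    show "rsquarefree (cpoly p)"
      using irreducible_imp_separable[OF assms(1)] by (simp add: separable_iff_rsquarefree)
    show "rsquarefree (cpoly ?c)" unfolding c by (rule rsquarefree_prod_linear) (simp add: inj_def)
  next
    fix z assume "poly (cpoly p) z = 0"
    then have "z \<noteq> of_nat i" for i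
      using irreducible_quadratic_no_real_root[of p "real i"] poly_cpoly_of_real[of p "real i"] assms
      by auto
    then show "poly (cpoly ?c) z \<noteq> 0"
      unfolding c by (auto simp: poly_prod)
  qed
  then show "separable (p * ?c)" by (simp only: separable_iff_rsquarefree cpoly_mult)
qed

section \<open>Perturbation along generic pencils and vanishing of forms\<close>

lemma eventually_at_finite_complement:
  fixes x :: "'a::t1_space"
  assumes "finite S"
  shows "\<forall>\<^sub>F y in at x. y \<notin> S"
proof -
  have "\<forall>\<^sub>F y in at x. \<forall>s\<in>S. y \<noteq> s"
    using assms by (rule eventually_ball_finite) (auto intro: eventually_neq_at_within)
  then show ?thesis by (rule eventually_mono) auto
qed

lemma isCont_eval_form_pencil:
  "isCont (\<lambda>e. eval_form \<Phi> (f + smult e F) (g + smult e G) (h + smult e H)) x"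
proof -
  have "isCont (\<lambda>e. coeff_val (f + smult e F) (g + smult e G) (h + smult e H) v) x" for v
    by (cases v) (auto intro!: continuous_intros)
  then show ?thesis unfolding eval_form_def by (intro continuous_intros)
qed

text \<open>Only finitely many complex parameters are bad, hence only finitely many real
  ones.\<close>

lemma eventually_separable_pencil:
  assumes "separable F"
  shows "\<forall>\<^sub>F e in at x. separable (f + smult e F)"
proof -
  have "finite (complex_of_real -` {e. \<not> rsquarefree (cpoly f + smult e (cpoly F))})"
    using assms by (intro finite_vimageI finite_not_rsquarefree_pencil)
      (auto simp: separable_iff_rsquarefree inj_def)
  from eventually_at_finite_complement[OF this, of x] show ?thesis
    by (rule eventually_mono) (simp add: separable_iff_rsquarefree cpoly_add cpoly_smult)
qed

lemma eventually_neq_0_affine: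
  fixes a b :: real
  assumes "b \<noteq> 0"
  shows "\<forall>\<^sub>F e in at x. a + e * b \<noteq> 0"
proof -
  have "\<forall>\<^sub>F e in at x. e \<noteq> - a / b" by (rule eventually_neq_at_within)
  then show ?thesis by (rule eventually_mono) (use assms in \<open>auto simp: field_simps\<close>)
qed

text \<open>Cramer's rule for the coefficient equations at i and j.\<close>

lemma lin_indep2_if_coeff_minor:
  assumes "coeff g i * coeff h j - coeff g j * coeff h i \<noteq> 0"
  shows "lin_indep2 g h"
  unfolding lin_indep2_def
proof (intro allI impI)
  fix a b assume *: "smult a g + smult b h = 0"
  have "a * coeff g i + b * coeff h i = 0" "a * coeff g j + b * coeff h j = 0"
    using arg_cong[OF *, of "\<lambda>q. coeff q i"] arg_cong[OF *, of "\<lambda>q. coeff q j"] by simp_all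
  moreover have "a * (coeff g i * coeff h j - coeff g j * coeff h i) =
      coeff h j * (a * coeff g i + b * coeff h i) - coeff h i * (a * coeff g j + b * coeff h j)"
    "b * (coeff g i * coeff h j - coeff g j * coeff h i) =
      coeff g i * (a * coeff g j + b * coeff h j) - coeff g j * (a * coeff g i + b * coeff h i)"
    by algebra+
  ultimately show "a = 0 \<and> b = 0" using assms by auto
qed

text \<open>The minor of the perturbed pair is a polynomial in e whose coefficient of
  \<open>e^2\<close> is the minor of G and H, so it has finitely many zeros.\<close>

lemma eventually_lin_indep2_pencil:
  assumes "coeff G i * coeff H j - coeff G j * coeff H i \<noteq> 0"
  shows "\<forall>\<^sub>F e in at x. lin_indep2 (g + smult e G) (h + smult e H)"
proof -
  let ?q = "[:coeff g i, coeff G i:] * [:coeff h j, coeff H j:] -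
    [:coeff g j, coeff G j:] * [:coeff h i, coeff H i:]"
  have "coeff ?q 2 \<noteq> 0" using assms by (simp add: numeral_2_eq_2 mult.commute)
  then have "?q \<noteq> 0" by (metis coeff_0)
  then have "finite {e. poly ?q e = 0}" by (rule poly_roots_finite)
  from eventually_at_finite_complement[OF this, of x] show ?thesis
    by (rule eventually_mono) (auto intro!: lin_indep2_if_coeff_minor[of _ i _ j] simp: algebra_simps)
qed

text \<open>The triple moves along a direction (F, G, H) that keeps p a common factor. For small
  nonzero e the moved triple satisfies the hypotheses in \<open>is_Phi\<close>, so the form vanishes
  there, and by continuity also at e = 0.\<close>

lemma eval_form_eq_0_if_common_factor:
  assumes Phi: "is_Phi m n \<Phi>" and mn: "2 \<le> m" "2 \<le> n"
    and deg: "degree f \<le> m" "degree g \<le> n" "degree h \<le> n"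
    and p: "irreducible p" "degree p = 2"
    and dvd: "p dvd f" "p dvd smult s g + smult t h" and st: "(s, t) \<noteq> (0, 0)"
  shows "eval_form \<Phi> f g h = 0"
proof -
  obtain F where F: "p dvd F" "separable F" "degree F = m"
    using obtain_separable_multiple p mn(1) by blast
  \<comment> \<open>The constants cancel in \<open>smult s G + smult t H\<close>, leaving a multiple
    of p. They also make the minor at degrees 0 and 2 equal to \<open>s^2 + t^2\<close> times the
    leading coefficient of p, which is nonzero for real s, t.\<close>
  define G where "G = smult s p + [:t:]"
  define H where "H = smult t p - [:s:]"
  have GH: "degree G \<le> n" "degree H \<le> n"
    unfolding G_def H_def using p mn
    by (auto intro!: degree_add_le degree_diff_le intro: order_trans[OF degree_smult_le])
  have "smult s G + smult t H = smult (s * s + t * t) p"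
    by (simp add: G_def H_def smult_add_right smult_diff_right smult_add_left mult.commute)
  then have pGH: "p dvd smult s G + smult t H" by (simp add: dvd_smult)
  have "s * s + t * t \<noteq> 0" using st by (auto simp: sum_squares_eq_zero_iff)
  moreover have "coeff p 2 \<noteq> 0" using p by (metis degree_0 leading_coeff_0_iff zero_neq_numeral)
  moreover have "coeff G 0 * coeff H 2 - coeff G 2 * coeff H 0 = coeff p 2 * (s * s + t * t)"
    by (simp add: G_def H_def numeral_2_eq_2 algebra_simps)
  ultimately have minor: "coeff G 0 * coeff H 2 - coeff G 2 * coeff H 0 \<noteq> 0" by simp
  have "coeff F m \<noteq> 0" using F by (auto simp: separable_def)
  let ?E = "\<lambda>e. eval_form \<Phi> (f + smult e F) (g + smult e G) (h + smult e H)"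
  have "\<forall>\<^sub>F e in at 0. ?E e = 0"
    using eventually_separable_pencil[OF F(2), of f 0]
      eventually_neq_0_affine[OF \<open>coeff F m \<noteq> 0\<close>, of "coeff f m" 0]
      eventually_lin_indep2_pencil[OF minor, of g h 0]
  proof eventually_elim
    case (elim e)
    let ?f = "f + smult e F" and ?g = "g + smult e G" and ?h = "h + smult e H"
    have d: "degree ?f \<le> m" "degree ?g \<le> n" "degree ?h \<le> n"
      using deg GH F by (auto intro!: degree_add_le intro: order_trans[OF degree_smult_le])
    have "m \<le> degree ?f" using elim(2) by (intro le_degree) simp
    have "p dvd ?f" using dvd F by (simp add: dvd_smult)
    have "smult s ?g + smult t ?h = (smult s g + smult t h) + smult e (smult s G + smult t H)"
      by (simp add: smult_add_right mult.commute)
    then have "p dvd smult s ?g + smult t ?h" using dvd pGH by (simp add: dvd_smult)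
    then have pc: "cpoly p dvd smult (of_real s) (cpoly ?g) + smult (of_real t) (cpoly ?h)"
      using cpoly_dvd by (metis cpoly_add cpoly_smult)
    have "degree (smult (of_real s) (cpoly ?g) + smult (of_real t) (cpoly ?h)) \<le> n"
      using d by (auto intro!: degree_add_le intro: order_trans[OF degree_smult_le] simp: degree_cpoly)
    \<comment> \<open>The quadratic p already has degree two, so no common root at infinity is
      counted: k = 0.\<close>
    with pc have "common_factor_ge2 m n (cpoly ?f) (smult (of_real s) (cpoly ?g) + smult (of_real t) (cpoly ?h))"
      unfolding common_factor_ge2_def using cpoly_dvd[OF \<open>p dvd ?f\<close>] d p
      by (intro exI[of _ "cpoly p"] exI[of _ 0]) (auto simp: degree_cpoly)
    moreover have "(complex_of_real s, complex_of_real t) \<noteq> (0, 0)" using st by simp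
    ultimately show ?case
      using Phi elim(1,3) d \<open>m \<le> degree ?f\<close> unfolding is_Phi_def
      by (metis (no_types, lifting) diff_le_self order_trans)
  qed
  then have "?E \<midarrow>0\<rightarrow> 0" by (rule tendsto_eventually)
  moreover have "?E \<midarrow>0\<rightarrow> ?E 0" using isCont_eval_form_pencil by (rule isContD)
  ultimately have "?E 0 = 0" by (rule LIM_unique[rotated])
  then show ?thesis by simp
qed

section \<open>Congruences modulo p at a double root\<close>

text \<open>
  c1 and c2 say that (f2 - T X) (4 f4 - X^2) - f3^2 has a double root at X = x modulo p; such
  triples form a surface, parametrized by y and w.  c3 says that the vector (d2, d3, d4) is
  tangent to it.
\<close>

lemma tangency_parametrization:
  fixes p :: "real poly"
  assumes p: "irreducible p" and t: "t \<noteq> 0" and T: "T = [:t:]"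
    and w: "w = T * x - f2" "\<not> p dvd w"
    and c1: "p dvd (f2 - T * x) * (4 * f4 - x^2) - f3^2"
    and c2: "p dvd 3 * T * x^2 - 2 * f2 * x - 4 * T * f4"
    and c3: "p dvd d2 * (4 * f4 - x^2) + 4 * d4 * (f2 - T * x) - 2 * f3 * d3"
  obtains y where "[f3 = 2 * y * w] (mod p)" "[f2 = - 2 * T^2 * y^2 - w] (mod p)"
    "[f4 = T^2 * y^4 - y^2 * w] (mod p)" "[d4 = - (y^2 * d2 + y * d3)] (mod p)"
proof -
  have prime: "prime_elem p" using p by (rule field_poly_irreducible_imp_prime)
  have unitT: "p dvd a" if "p dvd T * a" for a
    using that t by (simp add: T dvd_smult_iff)
  have unit2: "p dvd a" if "p dvd 2 * a" for a
    using that by (simp add: numeral_poly dvd_smult_iff)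
  have unitw: "p dvd a" if "p dvd w * a" for a
    using that w(2) prime by (metis prime_elem_dvd_mult_iff)
  have "coprime p w" using prime w(2) by (rule prime_elem_imp_coprime)
  then obtain u v where uv: "u * p + v * w = 1"
    using bezout_coefficients_fst_snd[of p w] by (metis coprime_imp_gcd_eq_1)
  \<comment> \<open>\<open>v\<close> inverts \<open>w\<close> modulo p, so \<open>y\<close>
    represents \<open>f3 / (2 * w)\<close>.\<close>
  define y where "y = smult (1 / 2) (v * f3)"
  have "2 * y = v * f3"
    by (simp add: y_def numeral_poly)
  then have "f3 - 2 * y * w = p * (u * f3)" using uv by algebra
  then have y: "p dvd f3 - 2 * y * w" by simp
  \<comment> \<open>\<open>w\<close> times the derivative in \<open>c2\<close> minus
    \<open>T\<close> times the cubic in \<open>c1\<close> eliminates \<open>f4\<close> and leaves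
    \<open>T * f3^2 + 2 * x * w^2\<close>; then \<open>2 * y * w\<close> replaces
    \<open>f3\<close>.\<close>
  have "p dvd w * (w * (2 * (x + 2 * T * y^2)))"
  proof -
    have "w * (w * (2 * (x + 2 * T * y^2))) =
      - T * ((f2 - T * x) * (4 * f4 - x^2) - f3^2)
      + w * (3 * T * x^2 - 2 * f2 * x - 4 * T * f4)
      - (f3 - 2 * y * w) * (T * (f3 + 2 * y * w))"
      unfolding w(1) by algebra
    then show ?thesis using c1 c2 y by (simp only: dvd_add dvd_diff dvd_mult dvd_mult2)
  qed
  then have x: "p dvd x + 2 * T * y^2" using unitw unit2 by blast
  have f2: "p dvd f2 - (- 2 * T^2 * y^2 - w)"
  proof -
    have "f2 - (- 2 * T^2 * y^2 - w) = T * (x + 2 * T * y^2)" unfolding w(1) by algebra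
    then show ?thesis using x by simp
  qed
  have f4: "p dvd f4 - (T^2 * y^4 - y^2 * w)"
  proof -
    \<comment> \<open>\<open>c2\<close> is linear in \<open>f4\<close>: it is solved after replacing
      \<open>x\<close> by \<open>- 2 * T * y^2\<close>.\<close>
    have "T * (4 * (f4 - (T^2 * y^4 - y^2 * w))) =
      (x + 2 * T * y^2) * (T * (x - 2 * T * y^2) + 2 * w)
      - (3 * T * x^2 - 2 * f2 * x - 4 * T * f4)"
      unfolding w(1) by algebra
    then have "p dvd T * (2 * (2 * (f4 - (T^2 * y^4 - y^2 * w))))"
      using c2 x by simp
    then show ?thesis using unitT unit2 by blast
  qed
  have d4: "p dvd d4 - (- (y^2 * d2 + y * d3))"
  proof -
    \<comment> \<open>Modulo p, \<open>4 * f4 - x^2\<close> is \<open>- 4 * y^2 * w\<close> and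
      \<open>f3\<close> is \<open>2 * y * w\<close>, so \<open>4 * w\<close> factors out of
      \<open>c3\<close>.\<close>
    have "w * (2 * (2 * (d4 - (- (y^2 * d2 + y * d3))))) =
      - 1 * (d2 * (4 * f4 - x^2) + 4 * d4 * (f2 - T * x) - 2 * f3 * d3)
      + d2 * (4 * (f4 - (T^2 * y^4 - y^2 * w)) - (x + 2 * T * y^2) * (x - 2 * T * y^2))
      - 2 * d3 * (f3 - 2 * y * w)"
      unfolding w(1) by algebra
    then have "p dvd w * (2 * (2 * (d4 - (- (y^2 * d2 + y * d3)))))"
      using c3 f4 x y by (simp only: dvd_add dvd_diff dvd_mult dvd_mult2)
    then show ?thesis using unitw unit2 by blast
  qed
  show thesis using that[of y] y f2 f4 d4 by (simp only: cong_iff_dvd_diff)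
qed

text \<open>With weights 1, 2, 0 for y, w, T the parametrization is weighted homogeneous, so the
  Euler vector (2 f2, 3 f3, 4 f4) satisfies the same tangency relation as (d2, d3, d4). Their cross
  product (g34, - g24, g23) is therefore a multiple of the normal \<open>(y^2, y, 1)\<close> modulo
  p.\<close>

lemma tangency_imp_common_factor:
  fixes p :: "real poly"
  assumes f3: "[f3 = 2 * y * w] (mod p)" and f2: "[f2 = - 2 * T^2 * y^2 - w] (mod p)"
    and f4: "[f4 = T^2 * y^4 - y^2 * w] (mod p)" and d4: "[d4 = - (y^2 * d2 + y * d3)] (mod p)"
    and g: "g23 = 2 * f2 * d3 - 3 * f3 * d2" "g24 = 2 * f2 * d4 - 4 * f4 * d2"
      "g34 = 3 * f3 * d4 - 4 * f4 * d3"
  shows "p dvd g24^2 - g23 * g34"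
    "p dvd g23 * (g23 * f3 - 2 * g24 * f2) - 4 * T^2 * (g24 * g34)"
proof -
  define G where "G = 2 * (- 2 * T^2 * y^2 - w) * d3 - 3 * (2 * y * w) * d2"
  have c23: "[g23 = G] (mod p)"
    unfolding g G_def by (intro cong_diff cong_mult cong_refl f2 f3)
  have "[g24 = 2 * (- 2 * T^2 * y^2 - w) * (- (y^2 * d2 + y * d3))
      - 4 * (T^2 * y^4 - y^2 * w) * d2] (mod p)"
    unfolding g by (intro cong_diff cong_mult cong_refl f2 f4 d4)
  also have "2 * (- 2 * T^2 * y^2 - w) * (- (y^2 * d2 + y * d3))
      - 4 * (T^2 * y^4 - y^2 * w) * d2 = - y * G"
    unfolding G_def by algebra
  finally have c24: "[g24 = - y * G] (mod p)" .
  have "[g34 = 3 * (2 * y * w) * (- (y^2 * d2 + y * d3)) - 4 * (T^2 * y^4 - y^2 * w) * d3] (mod p)"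
    unfolding g by (intro cong_diff cong_mult cong_refl f3 f4 d4)
  also have "3 * (2 * y * w) * (- (y^2 * d2 + y * d3)) - 4 * (T^2 * y^4 - y^2 * w) * d3 = y^2 * G"
    unfolding G_def by algebra
  finally have c34: "[g34 = y^2 * G] (mod p)" .
  have "[g24^2 = (- y * G)^2] (mod p)" by (intro cong_pow c24)
  also have "(- y * G)^2 = G * (y^2 * G)" by algebra
  also have "[G * (y^2 * G) = g23 * g34] (mod p)"
    by (intro cong_mult cong_sym[OF c23] cong_sym[OF c34])
  finally show "p dvd g24^2 - g23 * g34" by (simp add: cong_iff_dvd_diff)
  have "[g23 * (g23 * f3 - 2 * g24 * f2) =
      G * (G * (2 * y * w) - 2 * (- y * G) * (- 2 * T^2 * y^2 - w))] (mod p)"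
    by (intro cong_diff cong_mult cong_refl f2 f3 c23 c24)
  \<comment> \<open>The terms with \<open>w\<close> cancel, and both sides are
    \<open>- 4 * T^2 * y^3 * G^2\<close>.\<close>
  also have "G * (G * (2 * y * w) - 2 * (- y * G) * (- 2 * T^2 * y^2 - w)) =
      4 * T^2 * ((- y * G) * (y^2 * G))"
    by algebra
  also have "[4 * T^2 * ((- y * G) * (y^2 * G)) = 4 * T^2 * (g24 * g34)] (mod p)"
    by (intro cong_mult cong_refl cong_sym[OF c24] cong_sym[OF c34])
  finally show "p dvd g23 * (g23 * f3 - 2 * g24 * f2) - 4 * T^2 * (g24 * g34)"
    by (simp add: cong_iff_dvd_diff)
qed

section \<open>From the double root of the cubic to the vanishing of the form\<close>

theorem proposition1p4:
  fixes \<Phi> :: "nat \<Rightarrow> nat \<Rightarrow> int_mpoly"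
    and f2 f3 f4 \<xi> \<eta> g23 g24 g34 P A B p :: "real poly"
    and t :: real
  assumes Phi: "\<And>m n. 2 \<le> m \<Longrightarrow> 2 \<le> n \<Longrightarrow> is_Phi m n (\<Phi> m n)"
    and deg: "degree f2 \<le> 2" "degree f3 \<le> 3" "degree f4 \<le> 4" "degree \<xi> \<le> 2" "degree \<eta> \<le> 3"
    and t: "t \<noteq> 0"
    and eta: "\<eta>^2 = (f2 - smult t \<xi>) * (4 * f4 - \<xi>^2) - f3^2"
    and g23: "g23 = gbr 2 3 f2 f3"
    and g24: "g24 = gbr 2 4 f2 f4"
    and g34: "g34 = gbr 3 4 f3 f4"
    and cop: "coprime f3 f4" "coprime g23 g24" "coprime g34 g24"
    and Phi34: "eval_form (\<Phi> 3 4) f3 (f2^2) f4 \<noteq> 0"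
    and sep: "separable f3" "separable (4 * f2 * f4 - f3^2)"
    and p: "irreducible p" "degree p = 2"
    and p_dvd: "p dvd smult t (\<xi>^3) - f2 * \<xi>^2 - smult t (4 * f4 * \<xi>) + 4 * f2 * f4 - f3^2"
      "p dvd smult t (3 * \<xi>^2) - 2 * f2 * \<xi> - smult t (4 * f4)"
    and P: "P = g24^2 - g23 * g34"
    and A: "A = g23 * (g23 * f3 - 2 * g24 * f2)"
    and B: "B = g24 * g34"
  shows "eval_form (\<Phi> 8 9) P A B = 0"
proof -
  \<comment> \<open>As a constant polynomial, t enters the ring identities below as an ordinary
    factor.\<close>
  define T where "T = [:t:]"
  have smT: "smult t a = T * a" for a by (simp add: T_def)
  have prime: "prime_elem p" using p(1) by (rule field_poly_irreducible_imp_prime)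
  have c2: "p dvd 3 * T * \<xi>^2 - 2 * f2 * \<xi> - 4 * T * f4"
    using p_dvd(2) by (simp only: smT) (simp only: ac_simps)
  have "smult t (\<xi>^3) - f2 * \<xi>^2 - smult t (4 * f4 * \<xi>) + 4 * f2 * f4 - f3^2 = \<eta>^2"
    unfolding eta smT by algebra
  then have "p dvd \<eta>^2" using p_dvd(1) by simp
  then have p_eta: "p dvd \<eta>" using prime by (rule prime_elem_dvd_power[rotated])
  have c1: "p dvd (f2 - T * \<xi>) * (4 * f4 - \<xi>^2) - f3^2"
    using \<open>p dvd \<eta>^2\<close> by (simp only: eta smT)
  have c3: "p dvd pderiv f2 * (4 * f4 - \<xi>^2) + 4 * pderiv f4 * (f2 - T * \<xi>) - 2 * f3 * pderiv f3"
  proof -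
    have const: "pderiv T = 0" "pderiv (4 :: real poly) = 0"
      by (simp_all add: T_def numeral_poly pderiv_pCons)
    have "\<eta> * \<eta> = (f2 - T * \<xi>) * (4 * f4 - \<xi> * \<xi>) - f3 * f3"
      using eta by (simp add: smT power2_eq_square)
    from arg_cong[OF this, of pderiv]
    have "\<eta> * pderiv \<eta> + \<eta> * pderiv \<eta> =
        (f2 - T * \<xi>) * (4 * pderiv f4 - (\<xi> * pderiv \<xi> + \<xi> * pderiv \<xi>))
        + (4 * f4 - \<xi> * \<xi>) * (pderiv f2 - T * pderiv \<xi>)
        - (f3 * pderiv f3 + f3 * pderiv f3)"
      by (simp only: pderiv_mult pderiv_diff const mult_zero_right add_0_right)
    \<comment> \<open>The terms with \<open>pderiv \<xi>\<close> collect into a multiple of the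
      polynomial in \<open>c2\<close>, so they vanish modulo p.\<close>
    then have "pderiv f2 * (4 * f4 - \<xi>^2) + 4 * pderiv f4 * (f2 - T * \<xi>) - 2 * f3 * pderiv f3 =
        \<eta> * (2 * pderiv \<eta>) - pderiv \<xi> * (3 * T * \<xi>^2 - 2 * f2 * \<xi> - 4 * T * f4)"
      by algebra
    then show ?thesis using p_eta c2 by simp
  qed
  define w where "w = T * \<xi> - f2"
  have w: "\<not> p dvd w"
  proof
    assume "p dvd w"
    have "p dvd - w * (4 * f4 - \<xi>^2) - ((f2 - T * \<xi>) * (4 * f4 - \<xi>^2) - f3^2)"
      using c1 \<open>p dvd w\<close> by (simp only: dvd_diff dvd_mult2 dvd_minus_iff)
    also have "- w * (4 * f4 - \<xi>^2) - ((f2 - T * \<xi>) * (4 * f4 - \<xi>^2) - f3^2) = f3^2"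
      unfolding w_def by algebra
    finally have "p dvd f3^2" .
    then have f3: "p dvd f3" using prime by (rule prime_elem_dvd_power[rotated])
    \<comment> \<open>Since \<open>T * \<xi>\<close> is congruent to \<open>f2\<close>, multiplying
      \<open>c2\<close> by \<open>T\<close> gives
      \<open>3 * f2^2 - 2 * f2^2 - 4 * T^2 * f4\<close>.\<close>
    have "smult 1 (f2^2) + smult (- 4 * t^2) f4 = f2^2 - 4 * T^2 * f4"
      by (simp add: T_def numeral_poly power2_eq_square mult.commute)
    also have "\<dots> = T * (3 * T * \<xi>^2 - 2 * f2 * \<xi> - 4 * T * f4) - w * (3 * T * \<xi> + f2)"
      unfolding w_def by algebra
    finally have "p dvd smult 1 (f2^2) + smult (- 4 * t^2) f4"
      using c2 \<open>p dvd w\<close> by (simp only: dvd_diff dvd_mult dvd_mult2)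
    moreover have "degree (f2^2) \<le> 4"
      using degree_power_le[of f2 2] deg(1) by linarith
    ultimately have "eval_form (\<Phi> 3 4) f3 (f2^2) f4 = 0"
      using f3 deg
      by (intro eval_form_eq_0_if_common_factor[where s = 1 and t = "- 4 * t^2", OF Phi _ _ _ _ _ p]) auto
    then show False using Phi34 by simp
  qed
  obtain y where y: "[f3 = 2 * y * w] (mod p)" "[f2 = - 2 * T^2 * y^2 - w] (mod p)"
    "[f4 = T^2 * y^4 - y^2 * w] (mod p)"
    "[pderiv f4 = - (y^2 * pderiv f2 + y * pderiv f3)] (mod p)"
    using tangency_parametrization[OF p(1) t T_def w_def w c1 c2 c3] by blast
  have g: "g23 = 2 * f2 * pderiv f3 - 3 * f3 * pderiv f2"
    "g24 = 2 * f2 * pderiv f4 - 4 * f4 * pderiv f2"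
    "g34 = 3 * f3 * pderiv f4 - 4 * f4 * pderiv f3"
    by (simp_all add: g23 g24 g34 gbr_def)
  note cf = tangency_imp_common_factor[OF y g]
  have dg: "degree g23 \<le> 3" "degree g24 \<le> 4" "degree g34 \<le> 5"
    using degree_gbr_le[OF deg(1,2)] degree_gbr_le[OF deg(1,3)] degree_gbr_le[OF deg(2,3)]
    by (simp_all add: g23 g24 g34)
  have dm: "degree (a * b) \<le> k + l" if "degree a \<le> k" "degree b \<le> l" for a b :: "real poly" and k l
    using degree_mult_le[of a b] that by linarith
  have "degree P \<le> 8"
    unfolding P power2_eq_square
    using dm[OF dg(2) dg(2)] dm[OF dg(1) dg(3)] by (intro degree_diff_le) simp_all
  moreover have "degree (g23 * f3 - 2 * g24 * f2) \<le> 6"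
    using dm[OF dg(1) deg(2)] dm[OF dg(2) deg(1)]
    by (intro degree_diff_le) (simp_all add: numeral_poly)
  then have "degree A \<le> 9" using dm[OF dg(1)] by (fastforce simp: A)
  moreover have "degree B \<le> 9" using dm[OF dg(2,3)] by (simp add: B)
  moreover have "p dvd P" using cf(1) by (simp add: P)
  \<comment> \<open>The same coefficients \<open>1\<close> and \<open>- 4 * t^2\<close> as in the
    excluded case select the member of the pencil of A and B.\<close>
  moreover have "p dvd smult 1 A + smult (- 4 * t^2) B"
    using cf(2) by (simp add: A B T_def numeral_poly power2_eq_square mult.commute)
  ultimately show ?thesis
    by (intro eval_form_eq_0_if_common_factor[where s = 1 and t = "- 4 * t^2", OF Phi _ _ _ _ _ p]) auto
qed

end
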